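(* Let $(X,d)$ be an infinite metric space and let $\mathfrak{B}$ be a bornology on $X$ with a closed base such that $X\notin\mathfrak{B}$. The following statements are equivalent. (1) TWO has a winning Markov strategy in $\mathcal{O}_{\mathfrak{B}^s}(X)$. (2) ONE has a predetermined winning strategy in $\mathsf{G}_1(\mathcal{O}_{\mathfrak{B}^s},\mathcal{O}_{\mathfrak{B}^s})$ on $X$.
   Context: A bornology on a set $X$ is a family $\mathfrak{B}$ of subsets of $X$ that covers $X$, is closed under finite unions and is closed under taking subsets. A base of $\mathfrak{B}$ is a subfamily $\mathfrak{B}_0\subseteq\mathfrak{B}$ such that every $B\in\mathfrak{B}$ is contained in some $B_0\in\mathfrak{B}_0$; it is a closed base if all its members are closed in $X$. For $B\subseteq X$ and $\delta>0$, $B^\delta=\bigcup_{x\in B}\{y\in X: d(x,y)<\delta\}$. An open $\mathfrak{B}^s$-cover of $X$ is a family $\mathcal{U}$ of open subsets of $X$ that covers $X$ with $X\notin\mathcal{U}$ such that for every $B\in\mathfrak{B}$ there are $U\in\mathcal{U}$ and $\delta>0$ with $B^\delta\subseteq U$; $\mathcal{O}_{\mathfrak{B}^s}$ is the collection of all of them. In the game $\mathcal{O}_{\mathfrak{B}^s}(X)$, in each round $n\in\mathbb{N}$ ONE chooses $B_n\in\mathfrak{B}$ and TWO responds with an open set $U_n\ne X$ such that $B_n^{\delta_n}\subseteq U_n$ for some $\delta_n>0$. ONE wins if $\{U_n:n\in\mathbb{N}\}$ is an open $\mathfrak{B}^s$-cover of $X$; otherwise TWO wins. In the game $\mathsf{G}_1(\mathcal{A},\mathcal{C})$,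 in each round $n$ ONE chooses $A_n\in\mathcal{A}$ and TWO responds with $b_n\in A_n$; TWO wins if $\{b_n:n\in\mathbb{N}\}\in\mathcal{C}$, otherwise ONE wins. A predetermined strategy for ONE is one depending only on the round number $n$. A Markov strategy for TWO is one depending only on ONE's current move and the round number: in $\mathcal{O}_{\mathfrak{B}^s}(X)$ it is a function $\psi$ assigning to each $B\in\mathfrak{B}$ and $n\in\mathbb{N}$ a legal response $\psi(B,n)$ to $B$. Such a strategy is winning if the player using it wins every play. *)

theory Defs
  imports "HOL-Analysis.Analysis"
begin

definition bornology :: "'a set \<Rightarrow> 'a set set \<Rightarrow> bool" where
  "bornology X \<BB> \<longleftrightarrow>
     \<BB> \<subseteq> Pow X \<and> \<Union>\<BB> = X \<and>
     (\<forall>\<F>. finite \<F> \<and> \<F> \<subseteq> \<BB> \<longrightarrow> \<Union>\<F> \<in> \<BB>) \<and>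
     (\<forall>B\<in>\<BB>. \<forall>C. C \<subseteq> B \<longrightarrow> C \<in> \<BB>)"

definition bornology_base :: "'a set set \<Rightarrow> 'a set set \<Rightarrow> bool" where
  "bornology_base \<BB> \<BB>\<^sub>0 \<longleftrightarrow> \<BB>\<^sub>0 \<subseteq> \<BB> \<and> (\<forall>B\<in>\<BB>. \<exists>B\<^sub>0\<in>\<BB>\<^sub>0. B \<subseteq> B\<^sub>0)"

definition closed_base :: "'a set \<Rightarrow> ('a \<Rightarrow> 'a \<Rightarrow> real) \<Rightarrow> 'a set set \<Rightarrow> 'a set set \<Rightarrow> bool" where
  "closed_base X d \<BB> \<BB>\<^sub>0 \<longleftrightarrow>
     bornology_base \<BB> \<BB>\<^sub>0 \<and> (\<forall>B\<in>\<BB>\<^sub>0. closedin (Metric_space.mtopology X d) B)"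

definition enlargement :: "'a set \<Rightarrow> ('a \<Rightarrow> 'a \<Rightarrow> real) \<Rightarrow> 'a set \<Rightarrow> real \<Rightarrow> 'a set" where
  "enlargement X d B \<delta> = (\<Union>x\<in>B. Metric_space.mball X d x \<delta>)"

definition open_Bs_covers ::
  "'a set \<Rightarrow> ('a \<Rightarrow> 'a \<Rightarrow> real) \<Rightarrow> 'a set set \<Rightarrow> 'a set set set" where
  "open_Bs_covers X d \<BB> =
     {\<U>. (\<forall>U\<in>\<U>. openin (Metric_space.mtopology X d) U) \<and> \<Union>\<U> = X \<and> X \<notin> \<U> \<and>
          (\<forall>B\<in>\<BB>. \<exists>U\<in>\<U>. \<exists>\<delta>>0. enlargement X d B \<delta> \<subseteq> U)}"

text \<open>
  A play of either game is a pair of sequences: the moves of ONE and the moves of TWO.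
  The winner depends only on the set of TWO's moves, so the winning predicates take just
  that sequence.  The prefix \<open>Bs\<close> refers to the game \<open>\<O>\<^bsub>\<BB>\<^sup>s\<^esub>(X)\<close>, the prefix \<open>G1\<close> to \<open>G\<^sub>1(\<A>, \<C>)\<close>.
\<close>

definition legal_response ::
  "'a set \<Rightarrow> ('a \<Rightarrow> 'a \<Rightarrow> real) \<Rightarrow> 'a set \<Rightarrow> 'a set \<Rightarrow> bool" where
  "legal_response X d B U \<longleftrightarrow>
     openin (Metric_space.mtopology X d) U \<and> U \<noteq> X \<and> (\<exists>\<delta>>0. enlargement X d B \<delta> \<subseteq> U)"

definition Bs_play ::
  "'a set \<Rightarrow> ('a \<Rightarrow> 'a \<Rightarrow> real) \<Rightarrow> 'a set set \<Rightarrow> (nat \<Rightarrow> 'a set) \<Rightarrow> (nat \<Rightarrow> 'a set) \<Rightarrow> bool" where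
  "Bs_play X d \<BB> B U \<longleftrightarrow> (\<forall>n. B n \<in> \<BB> \<and> legal_response X d (B n) (U n))"

definition Bs_ONE_wins ::
  "'a set \<Rightarrow> ('a \<Rightarrow> 'a \<Rightarrow> real) \<Rightarrow> 'a set set \<Rightarrow> (nat \<Rightarrow> 'a set) \<Rightarrow> bool" where
  "Bs_ONE_wins X d \<BB> U \<longleftrightarrow> range U \<in> open_Bs_covers X d \<BB>"

definition Bs_Markov_strategy_TWO ::
  "'a set \<Rightarrow> ('a \<Rightarrow> 'a \<Rightarrow> real) \<Rightarrow> 'a set set \<Rightarrow> ('a set \<Rightarrow> nat \<Rightarrow> 'a set) \<Rightarrow> bool" where
  "Bs_Markov_strategy_TWO X d \<BB> \<psi> \<longleftrightarrow> (\<forall>B\<in>\<BB>. \<forall>n. legal_response X d B (\<psi> B n))"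

definition Bs_winning_Markov_strategy_TWO ::
  "'a set \<Rightarrow> ('a \<Rightarrow> 'a \<Rightarrow> real) \<Rightarrow> 'a set set \<Rightarrow> ('a set \<Rightarrow> nat \<Rightarrow> 'a set) \<Rightarrow> bool" where
  "Bs_winning_Markov_strategy_TWO X d \<BB> \<psi> \<longleftrightarrow>
     Bs_Markov_strategy_TWO X d \<BB> \<psi> \<and>
     (\<forall>B U. Bs_play X d \<BB> B U \<and> (\<forall>n. U n = \<psi> (B n) n) \<longrightarrow> \<not> Bs_ONE_wins X d \<BB> U)"

definition G1_play :: "'b set set \<Rightarrow> (nat \<Rightarrow> 'b set) \<Rightarrow> (nat \<Rightarrow> 'b) \<Rightarrow> bool" where
  "G1_play \<A> A b \<longleftrightarrow> (\<forall>n. A n \<in> \<A> \<and> b n \<in> A n)"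

definition G1_TWO_wins :: "'b set set \<Rightarrow> (nat \<Rightarrow> 'b) \<Rightarrow> bool" where
  "G1_TWO_wins \<C> b \<longleftrightarrow> range b \<in> \<C>"

definition G1_predetermined_strategy_ONE :: "'b set set \<Rightarrow> (nat \<Rightarrow> 'b set) \<Rightarrow> bool" where
  "G1_predetermined_strategy_ONE \<A> \<sigma> \<longleftrightarrow> (\<forall>n. \<sigma> n \<in> \<A>)"

definition G1_winning_predetermined_strategy_ONE ::
  "'b set set \<Rightarrow> 'b set set \<Rightarrow> (nat \<Rightarrow> 'b set) \<Rightarrow> bool" where
  "G1_winning_predetermined_strategy_ONE \<A> \<C> \<sigma> \<longleftrightarrow>
     G1_predetermined_strategy_ONE \<A> \<sigma> \<and>
     (\<forall>A b. G1_play \<A> A b \<and> (\<forall>n. A n = \<sigma> n) \<longrightarrow> \<not> G1_TWO_wins \<C> b)"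

end

theory Submission
  imports Defs
begin

text \<open>
  A winning Markov strategy turns into the predetermined strategy whose \<open>n\<close>-th cover consists of
  all responses TWO might give in round \<open>n\<close>. Conversely, TWO answers \<open>B\<close> in round \<open>n\<close> with a
  member of ONE's \<open>n\<close>-th cover that contains an enlargement of \<open>B\<close>. In both directions the two
  games produce the same sequence of open sets, and the winning conditions are complementary.
\<close>

lemma subset_enlargement:
  assumes "Metric_space X d" "B \<subseteq> X" "\<delta> > 0"
  shows "B \<subseteq> enlargement X d B \<delta>"
proof
  interpret Metric_space X d by fact
  fix x assume "x \<in> B"
  with assms show "x \<in> enlargement X d B \<delta>"
    unfolding enlargement_def by force
qed

text \<open>Legality of each response gives openness, properness and the enlargement condition. The
  union is all of \<open>X\<close> because each \<open>B\<close> lies in its own response and the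
  bornology covers \<open>X\<close>.\<close>

lemma range_Markov_strategy_in_open_Bs_covers:
  assumes X: "Metric_space X d" and \<BB>: "bornology X \<BB>"
    and \<psi>: "Bs_Markov_strategy_TWO X d \<BB> \<psi>"
  shows "(\<lambda>B. \<psi> B n) ` \<BB> \<in> open_Bs_covers X d \<BB>"
proof -
  interpret Metric_space X d by fact
  have legal: "legal_response X d B (\<psi> B n)" if "B \<in> \<BB>" for B
    using \<psi> that by (simp add: Bs_Markov_strategy_TWO_def)
  have "\<psi> B n \<subseteq> X" if "B \<in> \<BB>" for B
    using legal[OF that] openin_subset unfolding legal_response_def by fastforce
  moreover have "B \<subseteq> \<psi> B n" if "B \<in> \<BB>" for B
  proof -
    have "B \<subseteq> X" using \<BB> that by (auto simp: bornology_def)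
    with legal[OF that] subset_enlargement[OF X] show ?thesis
      unfolding legal_response_def by blast
  qed
  moreover have "\<Union>\<BB> = X" using \<BB> by (simp add: bornology_def)
  ultimately have "(\<Union>B\<in>\<BB>. \<psi> B n) = X" by blast
  with legal show ?thesis
    unfolding open_Bs_covers_def legal_response_def by blast
qed

text \<open>Such a cover omits \<open>X\<close>, so the member containing an enlargement of
  \<open>B\<close> is automatically a proper open set, as legality demands.\<close>

lemma legal_response_from_cover:
  assumes "\<U> \<in> open_Bs_covers X d \<BB>" "B \<in> \<BB>"
  shows "\<exists>U\<in>\<U>. legal_response X d B U"
  using assms unfolding open_Bs_covers_def legal_response_def by blast

lemma winning_predetermined_of_winning_Markov:
  assumes "Metric_space X d" "bornology X \<BB>"
    and \<psi>: "Bs_winning_Markov_strategy_TWO X d \<BB> \<psi>"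
  shows "G1_winning_predetermined_strategy_ONE (open_Bs_covers X d \<BB>) (open_Bs_covers X d \<BB>)
           (\<lambda>n. (\<lambda>B. \<psi> B n) ` \<BB>)"
proof -
  have M: "Bs_Markov_strategy_TWO X d \<BB> \<psi>"
    using \<psi> by (simp add: Bs_winning_Markov_strategy_TWO_def)
  have "range b \<notin> open_Bs_covers X d \<BB>" if "\<forall>n. b n \<in> (\<lambda>B. \<psi> B n) ` \<BB>" for b
  proof -
    \<comment> \<open>Each selected set is TWO's answer to some \<open>B\<close>; choosing one such
      \<open>B\<close> per round reconstructs moves of ONE against which \<open>b\<close> follows
      \<open>\<psi>\<close>.\<close>
    from that have "\<forall>n. \<exists>B. B \<in> \<BB> \<and> b n = \<psi> B n" by blast
    then obtain B where B: "\<forall>n. B n \<in> \<BB> \<and> b n = \<psi> (B n) n" by metis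
    with M have "Bs_play X d \<BB> B b"
      by (simp add: Bs_play_def Bs_Markov_strategy_TWO_def)
    with B \<psi> show ?thesis
      unfolding Bs_winning_Markov_strategy_TWO_def Bs_ONE_wins_def by blast
  qed
  with range_Markov_strategy_in_open_Bs_covers[OF assms(1,2) M] show ?thesis
    unfolding G1_winning_predetermined_strategy_ONE_def G1_predetermined_strategy_ONE_def
      G1_play_def G1_TWO_wins_def by metis
qed

lemma winning_Markov_of_winning_predetermined:
  assumes \<sigma>: "G1_winning_predetermined_strategy_ONE
                (open_Bs_covers X d \<BB>) (open_Bs_covers X d \<BB>) \<sigma>"
  shows "\<exists>\<psi>. Bs_winning_Markov_strategy_TWO X d \<BB> \<psi>"
proof -
  have cover: "\<sigma> n \<in> open_Bs_covers X d \<BB>" for n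
    using \<sigma> by (simp add: G1_winning_predetermined_strategy_ONE_def
        G1_predetermined_strategy_ONE_def)
  \<comment> \<open>The premise sits under the existential so that choice yields a total function;
    its values outside \<open>\<BB>\<close> are arbitrary.\<close>
  then have "\<forall>B n. \<exists>U. B \<in> \<BB> \<longrightarrow> U \<in> \<sigma> n \<and> legal_response X d B U"
    using legal_response_from_cover by blast
  then obtain \<psi> where \<psi>: "\<And>B n. B \<in> \<BB> \<Longrightarrow> \<psi> B n \<in> \<sigma> n \<and> legal_response X d B (\<psi> B n)"
    by metis
  have "\<not> Bs_ONE_wins X d \<BB> U" if "Bs_play X d \<BB> B U" "\<forall>n. U n = \<psi> (B n) n" for B U
  proof -
    \<comment> \<open>The responses themselves are selections from the covers
      \<open>\<sigma> n\<close>, so \<open>U\<close> loses for TWO in \<open>G1\<close>, which says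
      exactly that \<open>range U\<close> is not a cover of the required kind.\<close>
    have "G1_play (open_Bs_covers X d \<BB>) \<sigma> U"
      using that \<psi> cover by (simp add: G1_play_def Bs_play_def)
    with \<sigma> show ?thesis
      unfolding G1_winning_predetermined_strategy_ONE_def G1_TWO_wins_def Bs_ONE_wins_def by blast
  qed
  with \<psi> show ?thesis
    unfolding Bs_winning_Markov_strategy_TWO_def Bs_Markov_strategy_TWO_def by blast
qed

theorem theorem5p6:
  fixes X :: "'a set" and d :: "'a \<Rightarrow> 'a \<Rightarrow> real" and \<BB> :: "'a set set"
  assumes "Metric_space X d"
    and "infinite X"
    and "bornology X \<BB>"
    and "\<exists>\<BB>\<^sub>0. closed_base X d \<BB> \<BB>\<^sub>0"
    and "X \<notin> \<BB>"
  shows "(\<exists>\<psi>. Bs_winning_Markov_strategy_TWO X d \<BB> \<psi>) \<longleftrightarrow>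
         (\<exists>\<sigma>. G1_winning_predetermined_strategy_ONE
                (open_Bs_covers X d \<BB>) (open_Bs_covers X d \<BB>) \<sigma>)"
  using winning_predetermined_of_winning_Markov[OF assms(1,3)]
    winning_Markov_of_winning_predetermined by blast

end
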